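(* For every integer $k\ge 1$ and every integer $\ell\ge 0$, there are only finitely many (up to isomorphism) $k$-vertex-critical $(P_3+\ell P_1)$-free graphs.
   Context: All graphs are finite and simple. $\chi(G)$ is the chromatic number of $G$. A graph $G$ is $k$-vertex-critical if $\chi(G)=k$ and $\chi(G-v)<k$ for every vertex $v\in V(G)$. $P_n$ denotes the induced path on $n$ vertices, $P_1$ is a single vertex, $G+H$ denotes the disjoint union of $G$ and $H$, and $\ell P_1$ is the disjoint union of $\ell$ isolated vertices (so $P_3+0P_1=P_3$). A graph is $H$-free if it has no induced subgraph isomorphic to $H$. *)

theory Defs
  imports "Graph_Theory.Digraph_Isomorphism" "Graph_Theory.Pair_Digraph"
begin

text \<open>
  Finite simple graphs are the structures satisfying the locale predicate \<^const>\<open>graph\<close>: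
  finite, loop-free, symmetric digraphs without parallel arcs. An undirected edge is thus a pair of
  opposite arcs, and \<open>u \<rightarrow>\<^bsub>G\<^esub> v\<close> is adjacency. The null graph is allowed; its chromatic number is 0.
\<close>

definition proper_colouring :: "('a, 'b) pre_digraph \<Rightarrow> nat \<Rightarrow> ('a \<Rightarrow> nat) \<Rightarrow> bool" where
  "proper_colouring G k c \<longleftrightarrow>
     (\<forall>v \<in> verts G. c v < k) \<and> (\<forall>u v. u \<rightarrow>\<^bsub>G\<^esub> v \<longrightarrow> c u \<noteq> c v)"

definition chromatic_number :: "('a, 'b) pre_digraph \<Rightarrow> nat" where
  "chromatic_number G = (LEAST k. \<exists>c. proper_colouring G k c)"

definition vertex_critical :: "nat \<Rightarrow> ('a, 'b) pre_digraph \<Rightarrow> bool" where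
  "vertex_critical k G \<longleftrightarrow>
     graph G \<and> chromatic_number G = k \<and>
     (\<forall>v \<in> verts G. chromatic_number (pre_digraph.del_vert G v) < k)"

definition path_graph :: "nat \<Rightarrow> (nat, nat \<times> nat) pre_digraph" where
  "path_graph n = with_proj
     \<lparr>pverts = {..<n}, parcs = {(i, j). i < n \<and> j < n \<and> (j = Suc i \<or> i = Suc j)}\<rparr>"

definition edgeless_graph :: "nat \<Rightarrow> (nat, nat \<times> nat) pre_digraph" where
  "edgeless_graph n = with_proj \<lparr>pverts = {..<n}, parcs = {}\<rparr>"

definition disjoint_union ::
  "('a, 'b) pre_digraph \<Rightarrow> ('c, 'd) pre_digraph \<Rightarrow> ('a + 'c, 'b + 'd) pre_digraph" where
  "disjoint_union G H =
     \<lparr>verts = verts G <+> verts H, arcs = arcs G <+> arcs H,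
      tail = map_sum (tail G) (tail H), head = map_sum (head G) (head H)\<rparr>"

definition induced_free :: "('c, 'd) pre_digraph \<Rightarrow> ('a, 'b) pre_digraph \<Rightarrow> bool" where
  "induced_free H G \<longleftrightarrow> \<not> (\<exists>K. induced_subgraph K G \<and> digraph_iso K H)"

end

theory Submission
  imports Defs
begin

text \<open>
  Suppose a \<open>k\<close>-vertex-critical graph has a large maximal independent set \<open>M\<close>. A vertex with two
  neighbours in \<open>M\<close> is the centre of a \<open>P\<^sub>3\<close>, so it has fewer than \<open>l\<close> non-neighbours in \<open>M\<close>; the
  remaining vertices attach to exactly one member of \<open>M\<close> and form pairwise anticomplete cliques
  \<open>C i\<close> with \<open>i \<in> M\<close>. Every vertex of the first kind (the set \<open>B\<close>) is in fact complete to all but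
  fewer than \<open>l\<close> of these cliques. Let \<open>C s\<close> be a smallest clique and colour \<open>G - s\<close> with \<open>k - 1\<close>
  colours. Some other clique \<open>C t\<close> is complete to one representative of each colour used on \<open>B\<close>, so
  it uses only colours missing on \<open>B\<close>. As \<open>card (C s) \<le> card (C t)\<close>, these colours suffice to
  recolour \<open>C s\<close>, and \<open>G\<close> is \<open>(k - 1)\<close>-colourable, a contradiction. Hence colour classes are
  bounded, and so is the number of vertices.
\<close>

section \<open>Independent sets in critical graphs\<close>

lemma card_independent_le:
  fixes E :: "'a \<Rightarrow> 'a \<Rightarrow> bool" and q l :: nat
  assumes sym: "\<And>u v. E u v \<Longrightarrow> E v u" and irrefl: "\<And>u. \<not> E u u"
    and fin: "finite V"
    and free: "\<And>a b c J. \<lbrakk>{a, b, c} \<subseteq> V; E a b; E b c; \<not> E a c; a \<noteq> c; J \<subseteq> V; card J = l;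
        \<And>x y. x \<in> J \<Longrightarrow> y \<in> J \<Longrightarrow> \<not> E x y;
        \<And>x. x \<in> J \<Longrightarrow> \<not> E a x \<and> \<not> E b x \<and> \<not> E c x\<rbrakk> \<Longrightarrow> False"
    and crit: "\<And>v. v \<in> V \<Longrightarrow> \<exists>c. (\<forall>u \<in> V - {v}. c u < q) \<and>
        (\<forall>u \<in> V - {v}. \<forall>w \<in> V - {v}. E u w \<longrightarrow> c u \<noteq> c w)"
    and nocol: "\<nexists>c. (\<forall>u \<in> V. c u < q) \<and> (\<forall>u \<in> V. \<forall>w \<in> V. E u w \<longrightarrow> c u \<noteq> c w)"
    and I: "I \<subseteq> V" "\<And>x y. x \<in> I \<Longrightarrow> y \<in> I \<Longrightarrow> \<not> E x y"
  shows "card I \<le> q * l + 2 * l + 2"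
proof (rule ccontr)
  assume large: "\<not> ?thesis"
  define Ind where "Ind = {J. J \<subseteq> V \<and> (\<forall>x \<in> J. \<forall>y \<in> J. \<not> E x y)}"
  have "finite Ind" "I \<in> Ind"
    using fin I by (auto simp: Ind_def)
  \<comment> \<open>Maximality of \<open>M\<close> is what later gives every vertex outside
    \<open>M\<close> a neighbour in \<open>M\<close>.\<close>
  then obtain M where M: "M \<in> Ind" "I \<subseteq> M" and max: "\<And>J. J \<in> Ind \<Longrightarrow> M \<subseteq> J \<Longrightarrow> M = J"
    using finite_has_maximal2 by metis
  have MV: "M \<subseteq> V" and indep: "\<And>x y. x \<in> M \<Longrightarrow> y \<in> M \<Longrightarrow> \<not> E x y"
    using M by (auto simp: Ind_def)
  have finM: "finite M"
    using MV fin finite_subset by blast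
  \<comment> \<open>The bound serves three choices from \<open>M\<close>: \<open>l + 2\<close>
    members suffice for \<open>sub\<close>, \<open>2 * l + 2\<close> for the two path ends in
    \<open>few_bad\<close>, and \<open>q * l + 2\<close> for the clique index
    \<open>t\<close>.\<close>
  have cardM: "card M \<ge> q * l + 2 * l + 3"
    using large card_mono[OF finM M(2)] by linarith
  \<comment> \<open>These \<open>l\<close> members of \<open>M\<close> play the part of
    \<open>l P_1\<close>, once the one or two members of \<open>M\<close> tied to the path are
    excluded.\<close>
  have sub: "\<exists>J \<subseteq> M - X. card J = l" if "finite X" "card X \<le> 2" for X
  proof -
    have "card (M - X) \<ge> card M - card X"
      using that(1) by (rule diff_card_le_card_Diff)
    then have "l \<le> card (M - X)"
      using cardM that by linarith
    then show ?thesis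
      by (meson obtain_subset_with_card_n)
  qed

  \<comment> \<open>Cliques attached to the members of \<open>M\<close>\<close>
  define C where "C i = {x \<in> V. x = i \<or> (E x i \<and> (\<forall>j \<in> M. E x j \<longrightarrow> j = i))}" for i
  have CV: "C i \<subseteq> V" and self: "i \<in> M \<Longrightarrow> i \<in> C i" for i
    using MV by (auto simp: C_def)
  have adj: "E x i" if "x \<in> C i" "x \<noteq> i" for i x
    using that by (auto simp: C_def)
  have nbr: "j = i" if "i \<in> M" "x \<in> C i" "j \<in> M" "E x j" for i j x
    using that indep by (auto simp: C_def)
  \<comment> \<open>Two non-adjacent members would give the induced path \<open>x - i - y\<close>,
    whose vertices see no member of \<open>M\<close> but \<open>i\<close>; any \<open>l\<close>
    other members of \<open>M\<close> complete the forbidden graph.\<close>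
  have clique: "E x y" if i: "i \<in> M" and xy: "x \<in> C i" "y \<in> C i" "x \<noteq> y" for i x y
  proof (rule ccontr)
    assume nE: "\<not> E x y"
    then have "x \<noteq> i" "y \<noteq> i"
      using adj[OF xy(1)] sym[OF adj[OF xy(2)]] xy(3) by auto
    then have xi: "E x i" "E i y" "{x, i, y} \<subseteq> V"
      using adj[OF xy(1)] sym[OF adj[OF xy(2)]] xy i CV MV by auto
    obtain J where J: "J \<subseteq> M - {i}" "card J = l"
      using sub[of "{i}"] by auto
    show False
    proof (rule free[of x i y J])
      show "\<not> E z w" if "z \<in> J" "w \<in> J" for z w
        using that J indep by blast
    next
      show "\<not> E x z \<and> \<not> E i z \<and> \<not> E y z" if "z \<in> J" for z
        using that J nbr[OF i xy(1)] nbr[OF i xy(2)] indep i by blast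
    qed (use xi nE xy J MV indep in auto)
  qed
  \<comment> \<open>An edge between two classes would give the induced path
    \<open>y - x - i\<close>. Its only ties to \<open>M\<close> are \<open>i\<close> and
    \<open>j\<close>, so \<open>l\<close> members of \<open>M - {i, j}\<close> complete the
    forbidden graph.\<close>
  have anti: "\<not> E x y" if ij: "i \<in> M" "j \<in> M" "i \<noteq> j" and xy: "x \<in> C i" "y \<in> C j" for i j x y
  proof
    assume E: "E x y"
    have ne: "x \<noteq> i" "y \<noteq> i"
      using nbr[OF ij(2) xy(2) ij(1)] sym[OF E] adj[OF xy(2)] indep ij by auto
    have xi: "E y x" "E x i" "\<not> E y i" "{y, x, i} \<subseteq> V"
      using sym[OF E] ij ne adj[OF xy(1)] nbr[OF ij(2) xy(2) ij(1)] xy CV MV by auto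
    obtain J where J: "J \<subseteq> M - {i, j}" "card J = l"
      using sub[of "{i, j}"] ij by auto
    show False
    proof (rule free[of y x i J])
      show "\<not> E z w" if "z \<in> J" "w \<in> J" for z w
        using that J indep by blast
    next
      show "\<not> E y z \<and> \<not> E x z \<and> \<not> E i z" if "z \<in> J" for z
        using that J nbr[OF ij(1) xy(1)] nbr[OF ij(2) xy(2)] indep ij(1) by blast
    qed (use xi ne J MV indep in auto)
  qed
  have disj: "i = j" if "i \<in> M" "j \<in> M" "x \<in> C i" "x \<in> C j" for i j x
    using that adj[of x i] adj[of x j] nbr[of j x i] indep[of i j] by auto

  \<comment> \<open>Vertices with several neighbours in \<open>M\<close>\<close>
  define B where "B = V - (\<Union>i \<in> M. C i)"
  \<comment> \<open>A vertex of \<open>B\<close> is the middle of a path between two of its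
    neighbours in \<open>M\<close>, so \<open>l\<close> non-neighbours in \<open>M\<close> would
    complete the forbidden graph.\<close>
  have few_nonnbrs: "card {j \<in> M. \<not> E b j} < l" if b: "b \<in> B" for b
  proof (rule ccontr)
    assume "\<not> ?thesis"
    then obtain J where J: "J \<subseteq> {j \<in> M. \<not> E b j}" "card J = l"
      by (meson not_less obtain_subset_with_card_n)
    have bM: "b \<in> V" "b \<notin> M"
      using b self by (auto simp: B_def)
    have "\<exists>i \<in> M. E b i"
    proof (rule ccontr)
      assume "\<not> ?thesis"
      then have "\<not> E b i \<and> \<not> E i b" if "i \<in> M" for i
        using that sym[of i b] by blast
      then have "insert b M \<in> Ind"
        using bM MV indep irrefl by (auto simp: Ind_def)
      then show False
        using max[of "insert b M"] bM by auto
    qed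
    then obtain i where i: "i \<in> M" "E b i" by blast
    moreover have "b \<notin> C i"
      using b i by (auto simp: B_def)
    \<comment> \<open>With \<open>i\<close> as its only neighbour in \<open>M\<close>,
      \<open>b\<close> would belong to \<open>C i\<close>.\<close>
    ultimately obtain j where j: "j \<in> M" "E b j" "j \<noteq> i"
      using bM by (auto simp: C_def)
    show False
    proof (rule free[of i b j J])
      show "\<not> E z w" if "z \<in> J" "w \<in> J" for z w
        using that J indep by blast
    next
      show "\<not> E i z \<and> \<not> E b z \<and> \<not> E j z" if "z \<in> J" for z
        using that J i j indep by blast
    qed (use i j J MV bM indep sym[of b i] in auto)
  qed
  define bad where "bad b = {i \<in> M. \<exists>x \<in> C i. \<not> E b x}" for b
  \<comment> \<open>From each of \<open>l\<close> cliques not complete to \<open>b\<close>,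
    \<open>g\<close> picks a non-neighbour of \<open>b\<close>. The picks are independent by
    \<open>anti\<close>, and two neighbours of \<open>b\<close> in \<open>M\<close> from other
    cliques are the ends of the path.\<close>
  have few_bad: "card (bad b) < l" if b: "b \<in> B" for b
  proof (rule ccontr)
    assume "\<not> ?thesis"
    then obtain J where J: "J \<subseteq> bad b" "card J = l"
      by (meson not_less obtain_subset_with_card_n)
    then have "\<forall>i \<in> J. \<exists>x. x \<in> C i \<and> \<not> E b x"
      by (auto simp: bad_def)
    then obtain g where "\<forall>i \<in> J. g i \<in> C i \<and> \<not> E b (g i)"
      by (rule bchoice[THEN exE])
    then have g: "g i \<in> C i \<and> \<not> E b (g i)" if "i \<in> J" for i
      using that by blast
    have JM: "J \<subseteq> M"
      using J by (auto simp: bad_def)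
    have "inj_on g J"
    proof (rule inj_onI)
      fix i j assume "i \<in> J" "j \<in> J" "g i = g j"
      then show "i = j"
        using disj[of i j "g i"] g[of i] g[of j] JM by auto
    qed
    then have card: "card (g ` J) = l"
      using J by (simp add: card_image)
    \<comment> \<open>Path ends chosen in \<open>M\<close> outside \<open>?N\<close> are adjacent to
      \<open>b\<close>, and by \<open>anti\<close> they have no neighbour among the picks.\<close>
    let ?N = "J \<union> {j \<in> M. \<not> E b j}"
    have "card ?N \<le> l + l"
      using card_Un_le[of J "{j \<in> M. \<not> E b j}"] few_nonnbrs[OF b] J by linarith
    moreover have "card (M - ?N) \<ge> card M - card ?N"
      using JM finM by (intro diff_card_le_card_Diff) (auto intro: finite_subset)
    ultimately have "2 \<le> card (M - ?N)"
      using cardM by linarith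
    then obtain T where "T \<subseteq> M - ?N" "card T = 2"
      by (meson obtain_subset_with_card_n)
    then obtain i j where ij: "i \<in> M - ?N" "j \<in> M - ?N" "i \<noteq> j"
      by (auto simp: card_2_iff)
    show False
    proof (rule free[of i b j "g ` J"])
      show "\<not> E x y" if "x \<in> g ` J" "y \<in> g ` J" for x y
      proof -
        obtain h h' where h: "h \<in> J" "x = g h" and h': "h' \<in> J" "y = g h'"
          using \<open>x \<in> g ` J\<close> \<open>y \<in> g ` J\<close> by blast
        show ?thesis
          using anti[of h h' x y] h h' g JM irrefl by (cases "h = h'") auto
      qed
      show "\<not> E i z \<and> \<not> E b z \<and> \<not> E j z" if "z \<in> g ` J" for z
      proof -
        obtain h where h: "h \<in> J" "z = g h" using \<open>z \<in> g ` J\<close> by blast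
        then have "h \<in> M" "h \<noteq> i" "h \<noteq> j" "z \<in> C h" "\<not> E b z"
          using JM ij g by auto
        then show ?thesis
          using anti[of i h i z] anti[of j h j z] self ij by auto
      qed
      show "{i, b, j} \<subseteq> V"
        using ij b MV by (auto simp: B_def)
      show "g ` J \<subseteq> V"
        using g CV by blast
    qed (use ij card sym[of b i] indep in auto)
  qed

  \<comment> \<open>Recolouring the smallest clique\<close>
  have "M \<noteq> {}"
    using cardM by auto
  then obtain s where s: "s \<in> M" and smin: "\<And>t. t \<in> M \<Longrightarrow> card (C s) \<le> card (C t)"
    using ex_min_if_finite[of "(\<lambda>i. card (C i)) ` M"] finM by (auto simp: not_less)
  have "s \<in> V"
    using s MV by blast
  from crit[OF this] obtain c where "(\<forall>u \<in> V - {s}. c u < q) \<and>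
      (\<forall>u \<in> V - {s}. \<forall>w \<in> V - {s}. E u w \<longrightarrow> c u \<noteq> c w)" ..
  then have c: "\<And>u. u \<in> V - {s} \<Longrightarrow> c u < q"
      and cE: "\<And>u w. u \<in> V - {s} \<Longrightarrow> w \<in> V - {s} \<Longrightarrow> E u w \<Longrightarrow> c u \<noteq> c w"
    by auto
  have BV: "B \<subseteq> V - {s}"
    using self s by (auto simp: B_def)
  define D where "D = c ` B"
  have D: "D \<subseteq> {..<q}"
    using BV c by (auto simp: D_def)
  then have finD: "finite D" and cardD: "card D \<le> q"
    using card_mono[OF finite_lessThan D] by (auto intro: finite_subset)
  \<comment> \<open>\<open>B\<close> may be large, but one representative per colour of
    \<open>D\<close> suffices: these are at most \<open>q\<close> vertices, each spoiling fewer than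
    \<open>l\<close> cliques, so some clique other than \<open>C s\<close> is complete to all of
    them.\<close>
  define r where "r = inv_into B c"
  have r: "r d \<in> B \<and> c (r d) = d" if "d \<in> D" for d
    using that by (simp add: r_def D_def inv_into_into f_inv_into_f)
  have "card (\<Union>d \<in> D. bad (r d)) \<le> (\<Sum>d \<in> D. card (bad (r d)))"
    by (rule card_UN_le[OF finD])
  also have "\<dots> \<le> card D * l"
    using sum_bounded_above[of D "\<lambda>d. card (bad (r d))" l] few_bad r by (simp add: less_imp_le)
  also have "\<dots> \<le> q * l"
    using cardD by simp
  finally have "card (insert s (\<Union>d \<in> D. bad (r d))) < card M"
    using cardM card_insert_le_m1[of "Suc (q * l)" "\<Union>d \<in> D. bad (r d)" s] by simp
  moreover have "finite (insert s (\<Union>d \<in> D. bad (r d)))"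
    using finD finM by (simp add: bad_def)
  ultimately have "\<not> M \<subseteq> insert s (\<Union>d \<in> D. bad (r d))"
    using card_mono[of "insert s (\<Union>d \<in> D. bad (r d))" M] by linarith
  \<comment> \<open>\<open>t \<noteq> s\<close> keeps \<open>s\<close> out of \<open>C t\<close>, so
    the colouring \<open>c\<close> of \<open>V - {s}\<close> is proper on the whole of
    \<open>C t\<close>.\<close>
  then obtain t where t: "t \<in> M" "t \<noteq> s" "\<And>d. d \<in> D \<Longrightarrow> t \<notin> bad (r d)"
    by blast
  have Ct: "C t \<subseteq> V - {s}"
    using CV[of t] disj[OF t(1) s _ self[OF s]] t(2) by auto
  have "inj_on c (C t)"
  proof (rule inj_onI, rule ccontr)
    fix x y assume xy: "x \<in> C t" "y \<in> C t" "c x = c y" "x \<noteq> y"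
    then show False
      using cE[OF _ _ clique[OF t(1) xy(1,2,4)]] Ct by auto
  qed
  \<comment> \<open>Every \<open>x\<close> in \<open>C t\<close> is adjacent to the representative
    of each colour in \<open>D\<close>, so \<open>x\<close> cannot have such a colour.\<close>
  moreover have "c ` C t \<subseteq> {..<q} - D"
  proof clarsimp
    fix x assume x: "x \<in> C t"
    have "c x \<notin> D"
    proof
      assume d: "c x \<in> D"
      then have "E (r (c x)) x"
        using t x by (auto simp: bad_def)
      then show False
        using cE[of "r (c x)" x] r[OF d] BV Ct x by auto
    qed
    then show "c x < q \<and> c x \<notin> D"
      using c Ct x by auto
  qed
  ultimately have "card (C t) \<le> card ({..<q} - D)"
    by (metis card_inj_on_le finite_Diff finite_lessThan)
  \<comment> \<open>Minimality of \<open>C s\<close> turns the colours seen on \<open>C t\<close>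
    into enough colours for \<open>C s\<close>.\<close>
  then have "card (C s) \<le> card ({..<q} - D)"
    using smin[OF t(1)] by linarith
  moreover have "finite (C s)"
    using CV fin finite_subset by blast
  ultimately obtain g where g: "g ` C s \<subseteq> {..<q} - D" "inj_on g (C s)"
    using card_le_inj[of "C s" "{..<q} - D"] by auto
  define c' where "c' u = (if u \<in> C s then g u else c u)" for u
  have "c' u < q" if "u \<in> V" for u
    using that g c self[OF s] by (auto simp: c'_def)
  moreover have "c' u \<noteq> c' w" if uw: "u \<in> V" "w \<in> V" "E u w" for u w
  proof -
    \<comment> \<open>By \<open>anti\<close>, every neighbour of \<open>C s\<close> outside
      \<open>C s\<close> lies in \<open>B\<close>, so its colour is in \<open>D\<close> and differs
      from all values of \<open>g\<close> on \<open>C s\<close>.\<close>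
    have out: "c y \<in> D" if "x \<in> C s" "y \<notin> C s" "y \<in> V" "E x y" for x y
    proof -
      have "y \<notin> C i" if "i \<in> M" for i
        using anti[OF s that _ \<open>x \<in> C s\<close>] \<open>y \<notin> C s\<close> \<open>E x y\<close> by auto
      then show ?thesis
        using \<open>y \<in> V\<close> by (simp add: D_def B_def)
    qed
    have gD: "g x \<notin> D" if "x \<in> C s" for x
      using g that by auto
    have "u \<noteq> w"
      using uw irrefl by auto
    show ?thesis
    proof (cases "u \<in> C s"; cases "w \<in> C s")
      assume "u \<in> C s" "w \<in> C s"
      then show ?thesis
        using \<open>u \<noteq> w\<close> g(2) by (auto simp: c'_def dest: inj_onD)
    next
      assume "u \<in> C s" "w \<notin> C s"
      then show ?thesis
        using out[of u w] gD[of u] uw by (auto simp: c'_def)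
    next
      assume "u \<notin> C s" "w \<in> C s"
      then show ?thesis
        using out[of w u] gD[of w] uw sym[OF uw(3)] by (auto simp: c'_def)
    next
      assume "u \<notin> C s" "w \<notin> C s"
      then show ?thesis
        using cE[of u w] uw self[OF s] by (auto simp: c'_def)
    qed
  qed
  ultimately show False
    using nocol by blast
qed

section \<open>Invariance under isomorphism\<close>

lemma ex_colouring_iso:
  assumes "wf_digraph G" "digraph_iso G H" "\<exists>c. proper_colouring H k c"
  shows "\<exists>c. proper_colouring G k c"
proof -
  obtain h where h: "pre_digraph.digraph_isomorphism G h" and H: "H = app_iso h G"
    using assms(2) by (auto simp: digraph_iso_def)
  obtain c where c: "proper_colouring H k c"
    using assms(3) by blast
  have "iso_verts h u \<rightarrow>\<^bsub>H\<^esub> iso_verts h v" if "u \<rightarrow>\<^bsub>G\<^esub> v" for u v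
    using that wf_digraph.arcs_ends_app_iso_eq[OF assms(1) h] by (auto simp: H)
  then have "proper_colouring G k (c \<circ> iso_verts h)"
    using c by (auto simp: proper_colouring_def H)
  then show ?thesis by blast
qed

text \<open>Colourings are pulled back along the isomorphism and along its reverse, so both graphs
  admit the same numbers of colours.\<close>

lemma chromatic_number_iso:
  assumes "wf_digraph G" "digraph_iso G H"
  shows "chromatic_number H = chromatic_number G"
proof -
  have "wf_digraph H"
    using assms by (auto simp: digraph_iso_def intro: wf_digraph.wf_digraphI_app_iso)
  then have "(\<exists>c. proper_colouring H k c) = (\<exists>c. proper_colouring G k c)" for k
    using ex_colouring_iso digraph_iso_swap assms by metis
  then show ?thesis
    by (simp add: chromatic_number_def)
qed

text \<open>Injectivity of \<open>iso_verts h\<close> on \<open>verts G\<close>: only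
  \<open>v\<close> is sent to the deleted image, so exactly the arcs at \<open>v\<close>
  vanish.\<close>

lemma del_vert_app_iso:
  assumes "wf_digraph G" "pre_digraph.digraph_isomorphism G h" "v \<in> verts G"
  shows "pre_digraph.del_vert (app_iso h G) (iso_verts h v) = app_iso h (pre_digraph.del_vert G v)"
proof -
  interpret wf_digraph G by fact
  have "iso_verts h ` verts G - {iso_verts h v} = iso_verts h ` (verts G - {v})"
    using assms by (auto simp: digraph_isomorphism_def dest: inj_onD)
  moreover have "{a \<in> iso_arcs h ` arcs G. iso_tail h a \<noteq> iso_verts h v \<and> iso_head h a \<noteq> iso_verts h v}
      = iso_arcs h ` {a \<in> arcs G. tail G a \<noteq> v \<and> head G a \<noteq> v}"
    using assms by (auto simp: iso_verts_tail iso_verts_head)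
  ultimately show ?thesis
    by (simp add: pre_digraph.del_vert_def app_iso_def)
qed

lemma graph_app_iso:
  assumes "graph G" "pre_digraph.digraph_isomorphism G h"
  shows "graph (app_iso h G)"
proof -
  interpret graph G by fact
  interpret H: fin_digraph "app_iso h G"
    using assms(2) by (rule fin_digraphI_app_iso)
  have ends: "tail (app_iso h G) (iso_arcs h a) = iso_verts h (tail G a)"
      "head (app_iso h G) (iso_arcs h a) = iso_verts h (head G a)" if "a \<in> arcs G" for a
    using assms(2) that by (auto simp: iso_verts_tail iso_verts_head)
  have inj: "iso_verts h u = iso_verts h v \<longleftrightarrow> u = v" if "u \<in> verts G" "v \<in> verts G" for u v
    using assms(2) that by simp
  show ?thesis
  proof unfold_locales
    fix e assume "e \<in> arcs (app_iso h G)"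
    then obtain a where "a \<in> arcs G" "e = iso_arcs h a" by auto
    then show "tail (app_iso h G) e \<noteq> head (app_iso h G) e"
      using ends inj no_loops by simp
  next
    fix e1 e2
    assume "e1 \<in> arcs (app_iso h G)" "e2 \<in> arcs (app_iso h G)"
      and eq: "arc_to_ends (app_iso h G) e1 = arc_to_ends (app_iso h G) e2"
    then obtain a1 a2 where a: "a1 \<in> arcs G" "e1 = iso_arcs h a1" "a2 \<in> arcs G" "e2 = iso_arcs h a2"
      by auto
    then have "arc_to_ends G a1 = arc_to_ends G a2"
      using eq ends inj by (simp add: arc_to_ends_def)
    then show "e1 = e2"
      using no_multi_arcs a by blast
  next
    have "sym (arcs_ends G)"
      using sym_arcs by (simp add: symmetric_def)
    then show "symmetric (app_iso h G)"
      unfolding symmetric_def arcs_ends_app_iso_eq[OF assms(2)] by (auto simp: sym_def)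
  qed
qed

text \<open>Every vertex \<open>w\<close> of \<open>H\<close> is the image of some \<open>v\<close>,
  and \<open>h\<close> restricts to an isomorphism between the graphs with \<open>v\<close> and
  \<open>w\<close> deleted.\<close>

lemma vertex_critical_iso:
  assumes "vertex_critical k G" "digraph_iso G H"
  shows "vertex_critical k H"
proof -
  have G: "graph G" "wf_digraph G"
    using assms(1) by (auto simp: vertex_critical_def graph_def digraph_def fin_digraph_def)
  obtain h where h: "pre_digraph.digraph_isomorphism G h" and H: "H = app_iso h G"
    using assms(2) by (auto simp: digraph_iso_def)
  have "chromatic_number (pre_digraph.del_vert H w) < k" if "w \<in> verts H" for w
  proof -
    obtain v where v: "v \<in> verts G" "w = iso_verts h v"
      using \<open>w \<in> verts H\<close> H by auto
    have "pre_digraph.digraph_isomorphism (pre_digraph.del_vert G v) h"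
      using h wf_digraph.subgraph_del_vert[OF G(2)] by (rule pre_digraph.digraph_isomorphism_subgraphI)
    then have "digraph_iso (pre_digraph.del_vert G v) (pre_digraph.del_vert H w)"
      using del_vert_app_iso[OF G(2) h v(1)] H v(2) by (auto simp: digraph_iso_def)
    then have "chromatic_number (pre_digraph.del_vert H w) = chromatic_number (pre_digraph.del_vert G v)"
      by (rule chromatic_number_iso[OF wf_digraph.wf_digraph_del_vert[OF G(2)]])
    then show ?thesis
      using assms(1) v(1) by (simp add: vertex_critical_def)
  qed
  then show ?thesis
    using assms G graph_app_iso[OF G(1) h] chromatic_number_iso[OF G(2) assms(2)] H
    by (simp add: vertex_critical_def)
qed

text \<open>By injectivity on \<open>verts G\<close>, an image arc has both ends in the image of
  \<open>K\<close> only when the original arc has both ends in \<open>K\<close>.\<close>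

lemma induced_subgraph_app_iso:
  assumes "pre_digraph.digraph_isomorphism G h" "induced_subgraph K G"
  shows "induced_subgraph (app_iso h K) (app_iso h G)"
proof
  interpret pre_digraph G .
  have K: "subgraph K G" "arcs K = {e \<in> arcs G. tail G e \<in> verts K \<and> head G e \<in> verts K}"
    using assms(2) by (auto simp: induced_subgraph_def)
  show "subgraph (app_iso h K) (app_iso h G)"
    using assms(1) K(1) by (rule subgraph_app_isoI)
  have wf: "wf_digraph G" and V: "verts K \<subseteq> verts G"
    using K(1) by (auto simp: subgraph_def)
  have "iso_verts h u \<in> iso_verts h ` verts K \<longleftrightarrow> u \<in> verts K" if "u \<in> verts G" for u
    using that V assms(1) by (auto simp: digraph_isomorphism_def dest: inj_onD)
  then have "tail (app_iso h G) (iso_arcs h e) \<in> verts (app_iso h K) \<and>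
      head (app_iso h G) (iso_arcs h e) \<in> verts (app_iso h K) \<longleftrightarrow>
      tail G e \<in> verts K \<and> head G e \<in> verts K" if "e \<in> arcs G" for e
    using that assms(1) wf by (simp add: iso_verts_tail iso_verts_head wf_digraph_def)
  then show "arcs (app_iso h K) = {e \<in> arcs (app_iso h G).
      tail (app_iso h G) e \<in> verts (app_iso h K) \<and> head (app_iso h G) e \<in> verts (app_iso h K)}"
    unfolding arcs_app_iso K(2) by blast
qed

text \<open>An induced copy of \<open>P\<close> in \<open>H\<close> is carried back to
  \<open>G\<close> along the reversed isomorphism.\<close>

lemma induced_free_iso:
  assumes "wf_digraph G" "digraph_iso G H" "induced_free P G"
  shows "induced_free P H"
  unfolding induced_free_def
proof
  assume "\<exists>K. induced_subgraph K H \<and> digraph_iso K P"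
  then obtain K where K: "induced_subgraph K H" "digraph_iso K P"
    by blast
  have "wf_digraph H"
    using assms by (auto simp: digraph_iso_def intro: wf_digraph.wf_digraphI_app_iso)
  then have "digraph_iso H G"
    using assms digraph_iso_swap by metis
  then obtain h where h: "pre_digraph.digraph_isomorphism H h" and G: "G = app_iso h H"
    by (auto simp: digraph_iso_def)
  have KH: "subgraph K H"
    using K(1) by (rule induced_imp_subgraph)
  then have "wf_digraph K" "pre_digraph.digraph_isomorphism K h"
    using pre_digraph.digraph_isomorphism_subgraphI[OF h] by (auto simp: subgraph_def)
  then have "digraph_iso (app_iso h K) P"
    using K(2) digraph_iso_swap digraph_iso_trans by (metis digraph_iso_def)
  then show False
    using assms(3) induced_subgraph_app_iso[OF h K(1)] G by (auto simp: induced_free_def)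
qed

section \<open>Representatives on natural numbers\<close>

lemma digraph_iso_nat_graph:
  assumes "graph G"
  obtains P :: "nat pair_pre_digraph" where "digraph_iso G (with_proj P)"
    "pverts P = {..<card (verts G)}" "parcs P \<subseteq> pverts P \<times> pverts P"
proof -
  interpret graph G by fact
  obtain f where f: "bij_betw f (verts G) {..<card (verts G)}"
    using ex_bij_betw_finite_nat[OF finite_verts] by (auto simp: lessThan_atLeast0)
  \<comment> \<open>Arcs are renamed to the pairs of their numbered ends; as \<open>G\<close> has no
    parallel arcs, this renaming is injective.\<close>
  define e where "e = (\<lambda>a. (f (tail G a), f (head G a)))"
  define h where "h = \<lparr>iso_verts = f, iso_arcs = e, iso_head = snd, iso_tail = fst\<rparr>"
  define P where "P = \<lparr>pverts = f ` verts G, parcs = e ` arcs G\<rparr>"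
  have f': "inj_on f (verts G)" "f ` verts G = {..<card (verts G)}"
    using f by (auto simp: bij_betw_def)
  have "inj_on e (arcs G)"
    by (rule inj_onI) (auto intro!: no_multi_arcs inj_onD[OF f'(1)] simp: e_def arc_to_ends_def)
  then have "digraph_isomorphism h"
    using f'(1) wf_digraph by (auto simp: digraph_isomorphism_def h_def e_def)
  moreover have "with_proj P = app_iso h G"
    by (simp add: P_def h_def app_iso_def with_proj_def)
  ultimately have "digraph_iso G (with_proj P)"
    by (auto simp: digraph_iso_def)
  moreover have "pverts P = {..<card (verts G)}"
    using f'(2) by (simp add: P_def)
  moreover have "parcs P \<subseteq> pverts P \<times> pverts P"
    by (auto simp: P_def e_def)
  ultimately show ?thesis
    by (rule that)
qed

section \<open>Recognising an induced \<open>P_3 + l P_1\<close>\<close>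

lemma induced_subgraph_restrict:
  assumes "wf_digraph G" "W \<subseteq> verts G"
  shows "induced_subgraph \<lparr>verts = W, arcs = {e \<in> arcs G. tail G e \<in> W \<and> head G e \<in> W},
      tail = tail G, head = head G\<rparr> G"
  using assms by (auto simp: induced_subgraph_def subgraph_def compatible_def wf_digraph_def)

text \<open>Links the adjacency pattern used for independent sets to the definition by forbidden
  subgraphs: the subgraph induced on \<open>{a, b, c} \<union> J\<close> is matched explicitly with
  the disjoint union.\<close>

lemma P3_lP1_not_induced_free:
  assumes "graph G" and abc: "{a, b, c} \<subseteq> verts G" "a \<rightarrow>\<^bsub>G\<^esub> b" "b \<rightarrow>\<^bsub>G\<^esub> c" "\<not> a \<rightarrow>\<^bsub>G\<^esub> c" "a \<noteq> c"
    and J: "J \<subseteq> verts G" "card J = l" "\<And>x y. x \<in> J \<Longrightarrow> y \<in> J \<Longrightarrow> \<not> x \<rightarrow>\<^bsub>G\<^esub> y"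
      "\<And>x. x \<in> J \<Longrightarrow> \<not> a \<rightarrow>\<^bsub>G\<^esub> x \<and> \<not> b \<rightarrow>\<^bsub>G\<^esub> x \<and> \<not> c \<rightarrow>\<^bsub>G\<^esub> x"
  shows "\<not> induced_free (disjoint_union (path_graph 3) (edgeless_graph l)) G"
proof -
  interpret graph G by fact
  let ?P = "disjoint_union (path_graph 3) (edgeless_graph l)"
  define W where "W = {a, b, c} \<union> J"
  define K where "K = \<lparr>verts = W, arcs = {e \<in> arcs G. tail G e \<in> W \<and> head G e \<in> W},
      tail = tail G, head = head G\<rparr>"
  have sym: "v \<rightarrow>\<^bsub>G\<^esub> u" if "u \<rightarrow>\<^bsub>G\<^esub> v" for u v
    using that by (rule graph_symmetric)
  have irrefl: "\<not> u \<rightarrow>\<^bsub>G\<^esub> u" for u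
    using no_loops by (auto simp: arcs_ends_conv)
  \<comment> \<open>\<open>J\<close> misses the path since each of \<open>a\<close>,
    \<open>b\<close>, \<open>c\<close> has a neighbour on the path, while members of
    \<open>J\<close> have none there.\<close>
  have distinct: "a \<noteq> b" "b \<noteq> c" "a \<notin> J" "b \<notin> J" "c \<notin> J"
    using abc J(4) sym irrefl by blast+
  have finJ: "finite J"
    using J(1) finite_verts finite_subset by blast
  obtain p where p: "bij_betw p J {..<l}"
    using ex_bij_betw_finite_nat[OF finJ] J(2) by (auto simp: lessThan_atLeast0)
  define g where "g x = (if x = a then 0 else if x = b then 1 else 2 :: nat)" for x
  define f where "f x = (if x \<in> J then Inr (p x) else Inl (g x))" for x
  \<comment> \<open>Only the left summand has arcs, so every arc goes to \<open>Inl\<close>.\<close>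
  define e where "e i = (Inl (g (tail G i), g (head G i)) :: nat \<times> nat + nat \<times> nat)" for i
  define h where "h = \<lparr>iso_verts = f, iso_arcs = e, iso_head = head ?P, iso_tail = tail ?P\<rparr>"
  have P: "verts ?P = {..<3} <+> {..<l}"
      "arcs ?P = Inl ` {(0,1), (1,0), (1,2), (2,1)}"
      "tail ?P = map_sum fst fst" "head ?P = map_sum snd snd"
    by (auto simp: disjoint_union_def path_graph_def edgeless_graph_def numeral_3_eq_3 less_Suc_eq)
  have IK: "induced_subgraph K G"
    unfolding K_def using abc J(1) by (intro induced_subgraph_restrict wf_digraph) (auto simp: W_def)
  then have wfK: "wf_digraph K"
    by (auto simp: induced_subgraph_def subgraph_def)
  \<comment> \<open>Members of \<open>J\<close> are isolated in \<open>K\<close> and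
    \<open>a\<close>, \<open>c\<close> are non-adjacent, which leaves the two edges of the path in
    both directions.\<close>
  have arcs: "i \<in> arcs K \<longleftrightarrow> i \<in> arcs G \<and>
      (tail G i, head G i) \<in> {(a, b), (b, a), (b, c), (c, b)}" for i
  proof (cases "i \<in> arcs G")
    case True
    then have dom: "tail G i \<rightarrow>\<^bsub>G\<^esub> head G i"
      by (auto simp: arcs_ends_conv)
    have "(tail G i, head G i) \<in> {(a, b), (b, a), (b, c), (c, b)}"
      if "tail G i \<in> W" "head G i \<in> W"
    proof -
      have "tail G i \<notin> J" "head G i \<notin> J"
        using that dom sym[OF dom] J(3,4) unfolding W_def by auto
      then show ?thesis
        using that dom sym[of c a] irrefl abc(4) unfolding W_def by auto
    qed
    then show ?thesis
      using True by (auto simp: K_def W_def)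
  qed (auto simp: K_def)
  have tK: "tail K = tail G" "head K = head G" "verts K = W"
    by (auto simp: K_def)
  have gval: "g a = 0" "g b = 1" "g c = 2"
    using distinct abc(5) by (auto simp: g_def)
  have fval: "f a = Inl 0" "f b = Inl 1" "f c = Inl 2"
    using distinct gval by (auto simp: f_def)
  have "inj_on f W"
    using p distinct abc(5) gval unfolding W_def
    by (auto simp: inj_on_def f_def bij_betw_def)
  moreover have "f ` W = verts ?P"
  proof -
    have "f ` J = (\<lambda>x. Inr (p x)) ` J"
      by (rule image_cong) (simp_all add: f_def)
    also have "\<dots> = Inr ` {..<l}"
      using p by (simp add: bij_betw_def image_image[symmetric])
    finally have "f ` J = Inr ` {..<l}" .
    moreover have "{..<3::nat} = {0, 1, 2}"
      by auto
    ultimately show ?thesis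
      using fval by (simp add: W_def P image_Un Plus_def)
  qed
  moreover have "inj_on e (arcs K)"
  proof (rule inj_onI)
    fix i j assume ij: "i \<in> arcs K" "j \<in> arcs K" "e i = e j"
    have inj: "inj_on g {a, b, c}"
      using gval by (simp add: inj_on_def)
    have ends: "tail G x \<in> {a, b, c}" "head G x \<in> {a, b, c}" if "x \<in> arcs K" for x
      using that[unfolded arcs] by auto
    have "g (tail G i) = g (tail G j)" "g (head G i) = g (head G j)"
      using ij(3) by (simp_all add: e_def)
    then have "tail G i = tail G j" "head G i = head G j"
      using inj_onD[OF inj] ends ij(1,2) by blast+
    then show "i = j"
      using ij no_multi_arcs unfolding arcs arc_to_ends_def by blast
  qed
  moreover have "e ` arcs K = arcs ?P"
  proof -
    have "\<exists>i. i \<in> arcs G \<and> tail G i = u \<and> head G i = v" if "u \<rightarrow>\<^bsub>G\<^esub> v" for u v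
      using that by (auto simp: arcs_ends_conv)
    then obtain i1 i2 i3 i4 where i: "i1 \<in> arcs G" "tail G i1 = a" "head G i1 = b"
        "i2 \<in> arcs G" "tail G i2 = b" "head G i2 = a"
        "i3 \<in> arcs G" "tail G i3 = b" "head G i3 = c"
        "i4 \<in> arcs G" "tail G i4 = c" "head G i4 = b"
      using abc(2,3) sym by meson
    have "arcs ?P = e ` {i1, i2, i3, i4}"
      using i gval by (simp add: P e_def insert_commute)
    also have "\<dots> \<subseteq> e ` arcs K"
      using i by (intro image_mono) (auto simp: arcs)
    finally have "arcs ?P \<subseteq> e ` arcs K" .
    moreover have "e i \<in> arcs ?P" if "i \<in> arcs K" for i
      using that[unfolded arcs] gval unfolding P(2) e_def by (elim conjE insertE emptyE) simp_all
    ultimately show ?thesis by blast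
  qed
  moreover have "f (tail G i) = tail ?P (e i) \<and> f (head G i) = head ?P (e i)" if "i \<in> arcs K" for i
    using that[unfolded arcs] gval fval unfolding P(3,4) e_def by (elim conjE insertE emptyE) simp_all
  ultimately have "pre_digraph.digraph_isomorphism K h \<and> ?P = app_iso h K"
    using wfK by (auto simp: pre_digraph.digraph_isomorphism_def h_def app_iso_def tK)
  then have "digraph_iso K ?P"
    unfolding digraph_iso_def by blast
  then show ?thesis
    using IK by (auto simp: induced_free_def)
qed

section \<open>Bounding the order of a critical graph\<close>

lemma colouring_chromatic_number:
  assumes "fin_digraph G" "loopfree_digraph G"
  shows "\<exists>c. proper_colouring G (chromatic_number G) c"
proof -
  \<comment> \<open>An injective numbering of the vertices is a proper colouring, so the least
    number defining \<open>chromatic_number\<close> is taken over a non-empty set.\<close>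
  obtain f where f: "bij_betw f (verts G) {0..<card (verts G)}"
    using ex_bij_betw_finite_nat[OF fin_digraph.finite_verts[OF assms(1)]] by blast
  interpret loopfree_digraph G by fact
  have "f u \<noteq> f v" if "u \<rightarrow>\<^bsub>G\<^esub> v" for u v
  proof -
    have "u \<in> verts G" "v \<in> verts G" "u \<noteq> v"
      using that no_loops by (auto simp: arcs_ends_conv)
    then show ?thesis
      using f by (auto simp: bij_betw_def dest: inj_onD)
  qed
  moreover have "f v < card (verts G)" if "v \<in> verts G" for v
    using f that by (auto simp: bij_betw_def)
  ultimately have "proper_colouring G (card (verts G)) f"
    by (simp add: proper_colouring_def)
  then have "\<exists>c. proper_colouring G (card (verts G)) c"
    by blast
  then show ?thesis
    unfolding chromatic_number_def by (rule LeastI)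
qed

lemma chromatic_number_le:
  "proper_colouring G k c \<Longrightarrow> chromatic_number G \<le> k"
  unfolding chromatic_number_def by (blast intro: Least_le)

text \<open>A colouring with \<open>k\<close> colours splits the vertices into \<open>k\<close>
  independent sets, each of bounded size.\<close>

lemma card_verts_le:
  assumes crit: "vertex_critical k G"
    and free: "induced_free (disjoint_union (path_graph 3) (edgeless_graph l)) G"
  shows "card (verts G) \<le> k * (k * l + 2 * l + 2)"
proof -
  interpret graph G
    using crit by (simp add: vertex_critical_def)
  have chi: "chromatic_number G = k"
    and chi_del: "\<And>v. v \<in> verts G \<Longrightarrow> chromatic_number (del_vert v) < k"
    using crit by (auto simp: vertex_critical_def)
  have dom_verts: "u \<in> verts G" "v \<in> verts G" if "u \<rightarrow>\<^bsub>G\<^esub> v" for u v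
    using that by (auto simp: arcs_ends_conv)
  have dom_sym: "v \<rightarrow>\<^bsub>G\<^esub> u" if "u \<rightarrow>\<^bsub>G\<^esub> v" for u v
    using that by (rule graph_symmetric)
  have dom_irrefl: "\<not> u \<rightarrow>\<^bsub>G\<^esub> u" for u
    using no_loops by (auto simp: arcs_ends_conv)
  have indep: "card I \<le> k * l + 2 * l + 2"
    if I: "I \<subseteq> verts G" "\<And>x y. x \<in> I \<Longrightarrow> y \<in> I \<Longrightarrow> \<not> x \<rightarrow>\<^bsub>G\<^esub> y" for I
  proof (cases "verts G = {}")
    case False
    \<comment> \<open>With a vertex present, criticality puts a chromatic number strictly below
      \<open>k\<close>, so \<open>k - 1\<close> really is one less than \<open>k\<close>.\<close>
    then have "k > 0"
      using chi_del by fastforce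
    \<comment> \<open>The number \<open>q\<close> is \<open>k - 1\<close>: by criticality this many
      colours suffice once any vertex is deleted, but not for \<open>G\<close> itself.\<close>
    have "card I \<le> (k - 1) * l + 2 * l + 2"
    proof (rule card_independent_le[of "\<lambda>u v. u \<rightarrow>\<^bsub>G\<^esub> v" "verts G" l "k - 1" I])
      show False
        if "{a, b, c} \<subseteq> verts G" "a \<rightarrow>\<^bsub>G\<^esub> b" "b \<rightarrow>\<^bsub>G\<^esub> c" "\<not> a \<rightarrow>\<^bsub>G\<^esub> c" "a \<noteq> c" "J \<subseteq> verts G" "card J = l"
          "\<And>x y. x \<in> J \<Longrightarrow> y \<in> J \<Longrightarrow> \<not> x \<rightarrow>\<^bsub>G\<^esub> y"
          "\<And>x. x \<in> J \<Longrightarrow> \<not> a \<rightarrow>\<^bsub>G\<^esub> x \<and> \<not> b \<rightarrow>\<^bsub>G\<^esub> x \<and> \<not> c \<rightarrow>\<^bsub>G\<^esub> x" for a b c J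
        using P3_lP1_not_induced_free[OF graph_axioms that] free by contradiction
      show "\<exists>c. (\<forall>u \<in> verts G - {v}. c u < k - 1) \<and>
          (\<forall>u \<in> verts G - {v}. \<forall>w \<in> verts G - {v}. u \<rightarrow>\<^bsub>G\<^esub> w \<longrightarrow> c u \<noteq> c w)" if "v \<in> verts G" for v
      proof -
        have "loopfree_digraph (del_vert v)"
          using wf_digraph_del_vert no_loops
          by (auto simp: loopfree_digraph_def loopfree_digraph_axioms_def del_vert_simps)
        then obtain c where c: "proper_colouring (del_vert v) (chromatic_number (del_vert v)) c"
          using colouring_chromatic_number fin_digraph_del_vert by blast
        have "c u < k - 1" if "u \<in> verts G - {v}" for u
        proof -
          have "c u < chromatic_number (del_vert v)"
            using c that by (simp add: proper_colouring_def verts_del_vert)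
          then show ?thesis
            using chi_del[OF \<open>v \<in> verts G\<close>] by linarith
        qed
        moreover have "c u \<noteq> c w" if "u \<in> verts G - {v}" "w \<in> verts G - {v}" "u \<rightarrow>\<^bsub>G\<^esub> w" for u w
        proof -
          have "u \<rightarrow>\<^bsub>del_vert v\<^esub> w"
            using that by (auto simp: arcs_ends_conv del_vert_simps)
          then show ?thesis
            using c by (auto simp: proper_colouring_def)
        qed
        ultimately show ?thesis by blast
      qed
      show "\<nexists>c. (\<forall>u \<in> verts G. c u < k - 1) \<and> (\<forall>u \<in> verts G. \<forall>w \<in> verts G. u \<rightarrow>\<^bsub>G\<^esub> w \<longrightarrow> c u \<noteq> c w)"
      proof
        assume "\<exists>c. (\<forall>u \<in> verts G. c u < k - 1) \<and> (\<forall>u \<in> verts G. \<forall>w \<in> verts G. u \<rightarrow>\<^bsub>G\<^esub> w \<longrightarrow> c u \<noteq> c w)"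
        then obtain c where c: "\<forall>u \<in> verts G. c u < k - 1"
            "\<forall>u \<in> verts G. \<forall>w \<in> verts G. u \<rightarrow>\<^bsub>G\<^esub> w \<longrightarrow> c u \<noteq> c w"
          by blast
        have "proper_colouring G (k - 1) c"
          unfolding proper_colouring_def using c dom_verts by blast
        then show False
          using chromatic_number_le chi \<open>k > 0\<close> by fastforce
      qed
    qed (use I dom_sym dom_irrefl in auto)
    also have "\<dots> \<le> k * l + 2 * l + 2"
      by simp
    finally show ?thesis .
  qed (use I in auto)
  have "fin_digraph G" "loopfree_digraph G"
    by unfold_locales
  then obtain c where c: "proper_colouring G k c"
    using colouring_chromatic_number chi by blast
  then have "verts G = (\<Union>i \<in> {..<k}. {v \<in> verts G. c v = i})"
    by (auto simp: proper_colouring_def)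
  then have "card (verts G) \<le> (\<Sum>i \<in> {..<k}. card {v \<in> verts G. c v = i})"
    using card_UN_le[of "{..<k}" "\<lambda>i. {v \<in> verts G. c v = i}"] by simp
  also have "\<dots> \<le> card {..<k} * (k * l + 2 * l + 2)"
  proof (rule sum_bounded_above[where K = "k * l + 2 * l + 2", unfolded of_nat_id])
    have "\<not> u \<rightarrow>\<^bsub>G\<^esub> v" if "c u = c v" for u v
      using c that by (auto simp: proper_colouring_def)
    then show "card {v \<in> verts G. c v = i} \<le> k * l + 2 * l + 2" for i
      by (intro indep) auto
  qed
  finally show ?thesis by simp
qed

section \<open>A finite list of representatives\<close>

theorem theorem3:
  fixes k l :: nat
  assumes "k \<ge> 1"
  shows "\<exists>S :: (nat, nat \<times> nat) pre_digraph set.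
           finite S \<and>
           (\<forall>H \<in> S. vertex_critical k H \<and>
              induced_free (disjoint_union (path_graph 3) (edgeless_graph l)) H) \<and>
           (\<forall>G :: ('a, 'b) pre_digraph.
              vertex_critical k G \<and>
              induced_free (disjoint_union (path_graph 3) (edgeless_graph l)) G \<longrightarrow>
              (\<exists>H \<in> S. digraph_iso G H))"
proof -
  let ?free = "\<lambda>H. induced_free (disjoint_union (path_graph 3) (edgeless_graph l)) H"
  define N where "N = k * (k * l + 2 * l + 2)"
  \<comment> \<open>\<open>T\<close> is finite and contains a copy of every graph with at most
    \<open>N\<close> vertices; \<open>S\<close> keeps the members with both required properties,
    which a copy of \<open>G\<close> inherits by invariance under isomorphism.\<close>
  define T where "T = (\<lambda>(V, A). with_proj \<lparr>pverts = V, parcs = A\<rparr>) ` (Pow {..<N} \<times> Pow ({..<N} \<times> {..<N}))"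
  define S where "S = {H \<in> T. vertex_critical k H \<and> ?free H}"
  have "finite S"
    by (simp add: S_def T_def)
  moreover have "\<exists>H \<in> S. digraph_iso G H"
    if G: "vertex_critical k G" "?free G" for G :: "('a, 'b) pre_digraph"
  proof -
    interpret graph G
      using G by (simp add: vertex_critical_def)
    obtain P :: "nat pair_pre_digraph" where P: "digraph_iso G (with_proj P)"
        "pverts P = {..<card (verts G)}" "parcs P \<subseteq> pverts P \<times> pverts P"
      using digraph_iso_nat_graph[OF graph_axioms] .
    have "pverts P \<subseteq> {..<N}"
      using P(2) card_verts_le[OF G] by (simp add: N_def)
    then have "(pverts P, parcs P) \<in> Pow {..<N} \<times> Pow ({..<N} \<times> {..<N})"
      using P(3) by auto
    then have "with_proj P \<in> T"
      unfolding T_def by (rule rev_image_eqI) simp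
    then have "with_proj P \<in> S"
      using vertex_critical_iso[OF G(1) P(1)] induced_free_iso[OF wf_digraph P(1) G(2)]
      by (simp add: S_def)
    then show ?thesis
      using P(1) by blast
  qed
  ultimately show ?thesis
    by (intro exI[of _ S]) (auto simp: S_def)
qed

end
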